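(* Let $\Gamma$ be a nonempty finite set, let $A\subseteq\Gamma$ be non-trivial (i.e. $A\ne\emptyset$ and $A\ne\Gamma$), and let $\mathcal B\subseteq\mathcal P(\Gamma)$ be a non-empty family of generators. Then $D_\cap(A\mid\mathcal B)\le\rho(A,\mathcal B)^2$.
   Context: A sequence $A_1,\dots,A_t$ ($t\ge1$) of subsets of $\Gamma$ generates $A$ from $\mathcal B$ if $A_t=A$ and each $A_i$ equals $X\cup Y$ or $X\cap Y$ for some (not necessarily distinct) $X,Y\in\mathcal B\cup\{A_1,\dots,A_{i-1}\}$. $D_\cap(A\mid\mathcal B)$ is the minimum number of intersection steps over all sequences generating $A$ from $\mathcal B$ ($\infty$ if none). Cover complexity: let $U=\Gamma\setminus A$. A semi-filter over $U$ is a nonempty family $\mathcal F\subseteq\mathcal P(U)$ with $\emptyset\notin\mathcal F$ such that $U_1\in\mathcal F$ and $U_1\subseteq U_2\subseteq U$ imply $U_2\in\mathcal F$. $\mathcal F$ is above $w\in\Gamma$ if for every $B\in\mathcal B$ with $w\in B$ we have $B\cap U\in\mathcal F$. $\mathcal F$ preserves a pair $(E,H)$ of subsets of $U$ if $E,H\in\mathcal F$ imply $E\cap H\in\mathcal F$; it preserves a collection $\Lambda$ if it preserves each pair. $\rho(A,\mathcal B)$ is the minimum size of a collection $\Lambda$ of pairs of subsets of $U$ such that no semi-filter over $U$ that preserves $\Lambda$ is above some $a\in A$ ($\infty$ if none exists). *)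

theory Defs
  imports Main "HOL-Library.Extended_Nat"
begin

text \<open>A generating sequence is a list \<open>As\<close> of subsets of \<open>\<Gamma>\<close>, together with the set \<open>I\<close> of the
  positions that are read as intersection steps; the other positions are union steps. A set that
  arises in both ways may be labelled either way, so minimising \<open>card I\<close> counts it as a union.\<close>

definition generates ::
  "'a set \<Rightarrow> 'a set set \<Rightarrow> 'a set \<Rightarrow> 'a set list \<Rightarrow> nat set \<Rightarrow> bool" where
  "generates \<Gamma> \<B> A As I \<longleftrightarrow>
     As \<noteq> [] \<and> set As \<subseteq> Pow \<Gamma> \<and> last As = A \<and> I \<subseteq> {..<length As} \<and>
     (\<forall>i<length As. \<exists>X \<in> \<B> \<union> set (take i As). \<exists>Y \<in> \<B> \<union> set (take i As).
        As ! i = (if i \<in> I then X \<inter> Y else X \<union> Y))"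

text \<open>In \<^typ>\<open>enat\<close> the infimum of a nonempty set is its minimum, and the infimum of the empty set
  is \<open>\<infinity>\<close>.\<close>

definition intersection_complexity :: "'a set \<Rightarrow> 'a set \<Rightarrow> 'a set set \<Rightarrow> enat" where
  "intersection_complexity \<Gamma> A \<B> = Inf {enat (card I) | As I. generates \<Gamma> \<B> A As I}"

definition semi_filter :: "'a set \<Rightarrow> 'a set set \<Rightarrow> bool" where
  "semi_filter U \<F> \<longleftrightarrow>
     \<F> \<noteq> {} \<and> \<F> \<subseteq> Pow U \<and> {} \<notin> \<F> \<and>
     (\<forall>U1 U2. U1 \<in> \<F> \<and> U1 \<subseteq> U2 \<and> U2 \<subseteq> U \<longrightarrow> U2 \<in> \<F>)"

definition above :: "'a set \<Rightarrow> 'a set set \<Rightarrow> 'a set set \<Rightarrow> 'a \<Rightarrow> bool" where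
  "above U \<B> \<F> w \<longleftrightarrow> (\<forall>B\<in>\<B>. w \<in> B \<longrightarrow> B \<inter> U \<in> \<F>)"

definition preserves :: "'a set set \<Rightarrow> ('a set \<times> 'a set) set \<Rightarrow> bool" where
  "preserves \<F> \<Lambda> \<longleftrightarrow> (\<forall>(E, H)\<in>\<Lambda>. E \<in> \<F> \<and> H \<in> \<F> \<longrightarrow> E \<inter> H \<in> \<F>)"

definition covering_collection ::
  "'a set \<Rightarrow> 'a set \<Rightarrow> 'a set set \<Rightarrow> ('a set \<times> 'a set) set \<Rightarrow> bool" where
  "covering_collection \<Gamma> A \<B> \<Lambda> \<longleftrightarrow>
     \<Lambda> \<subseteq> Pow (\<Gamma> - A) \<times> Pow (\<Gamma> - A) \<and>
     \<not> (\<exists>\<F>. semi_filter (\<Gamma> - A) \<F> \<and> preserves \<F> \<Lambda> \<and> (\<exists>a\<in>A. above (\<Gamma> - A) \<B> \<F> a))"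

text \<open>For finite \<open>\<Gamma>\<close> every covering collection is finite, so \<^const>\<open>card\<close> is its size.\<close>

definition cover_complexity :: "'a set \<Rightarrow> 'a set \<Rightarrow> 'a set set \<Rightarrow> enat" where
  "cover_complexity \<Gamma> A \<B> = Inf {enat (card \<Lambda>) | \<Lambda>. covering_collection \<Gamma> A \<B> \<Lambda>}"

end

theory Submission
  imports Defs
begin

text \<open>Fix a covering collection \<open>\<Lambda>\<close> of \<open>m\<close> pairs. For a point \<open>w\<close>, close the family of all
  supersets of the sets \<open>B \<inter> U\<close> with \<open>w \<in> B\<close> under the rule ``if \<open>(E, H) \<in> \<Lambda>\<close> and \<open>E\<close>, \<open>H\<close> are in
  the family, add all supersets of \<open>E \<inter> H\<close>''. Each pair fires at most once, so \<open>m\<close> rounds reach the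
  closure. If \<open>w \<in> A\<close>, the closure contains the empty set, since otherwise it would be a forbidden
  semi-filter; if \<open>w \<in> U\<close>, all its members contain \<open>w\<close>. Running this process for all \<open>w\<close> at once,
  the points whose family contains \<open>V\<close> after \<open>t + 1\<close> rounds form a union of generators and of the
  \<open>m\<close> sets obtained by intersecting, for each pair in \<open>\<Lambda>\<close>, the two sets attached to its components
  after \<open>t\<close> rounds. Hence \<open>m\<close> rounds cost \<open>m\<^sup>2\<close> intersections.\<close>

section \<open>Counting intersections along growing families of sets\<close>

text \<open>The empty set is free here although it need not be generated: a union step with it is
  redundant and an intersection step with it yields it again, so it can be removed afterwards.\<close>

inductive derivable :: "'a set set \<Rightarrow> nat \<Rightarrow> 'a set set \<Rightarrow> bool" for \<B> where
  start: "derivable \<B> 0 (insert {} \<B>)"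
| union: "derivable \<B> k S \<Longrightarrow> X \<in> S \<Longrightarrow> Y \<in> S \<Longrightarrow> derivable \<B> k (insert (X \<union> Y) S)"
| inter: "derivable \<B> k S \<Longrightarrow> X \<in> S \<Longrightarrow> Y \<in> S \<Longrightarrow> derivable \<B> (Suc k) (insert (X \<inter> Y) S)"

text \<open>This is \<open>generates\<close> without a target and with the empty list allowed, so
  that an induction can start at \<open>[]\<close> and append.\<close>

definition steps :: "'a set \<Rightarrow> 'a set set \<Rightarrow> 'a set list \<Rightarrow> nat set \<Rightarrow> bool" where
  "steps \<Gamma> \<B> As I \<longleftrightarrow>
     set As \<subseteq> Pow \<Gamma> \<and> I \<subseteq> {..<length As} \<and>
     (\<forall>i<length As. \<exists>X \<in> \<B> \<union> set (take i As). \<exists>Y \<in> \<B> \<union> set (take i As).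
        As ! i = (if i \<in> I then X \<inter> Y else X \<union> Y))"

lemma steps_union:
  assumes "steps \<Gamma> \<B> As I" "\<B> \<subseteq> Pow \<Gamma>" "X \<in> \<B> \<union> set As" "Y \<in> \<B> \<union> set As"
  shows "steps \<Gamma> \<B> (As @ [X \<union> Y]) I"
  unfolding steps_def
proof (intro conjI allI impI)
  show "set (As @ [X \<union> Y]) \<subseteq> Pow \<Gamma>" "I \<subseteq> {..<length (As @ [X \<union> Y])}"
    using assms by (auto simp: steps_def)
  fix i assume i: "i < length (As @ [X \<union> Y])"
  show "\<exists>X' \<in> \<B> \<union> set (take i (As @ [X \<union> Y])). \<exists>Y' \<in> \<B> \<union> set (take i (As @ [X \<union> Y])).
        (As @ [X \<union> Y]) ! i = (if i \<in> I then X' \<inter> Y' else X' \<union> Y')"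
  proof (cases "i < length As")
    case True
    then show ?thesis using assms(1) by (simp add: steps_def nth_append)
  next
    case False
    with i have "i = length As" by simp
    moreover from this have "i \<notin> I" using assms(1) by (auto simp: steps_def)
    ultimately show ?thesis using assms(3,4) by auto
  qed
qed

lemma steps_inter:
  assumes "steps \<Gamma> \<B> As I" "\<B> \<subseteq> Pow \<Gamma>" "X \<in> \<B> \<union> set As" "Y \<in> \<B> \<union> set As"
  shows "steps \<Gamma> \<B> (As @ [X \<inter> Y]) (insert (length As) I)"
  unfolding steps_def
proof (intro conjI allI impI)
  show "set (As @ [X \<inter> Y]) \<subseteq> Pow \<Gamma>" "insert (length As) I \<subseteq> {..<length (As @ [X \<inter> Y])}"
    using assms by (auto simp: steps_def)
  fix i assume i: "i < length (As @ [X \<inter> Y])"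
  show "\<exists>X' \<in> \<B> \<union> set (take i (As @ [X \<inter> Y])). \<exists>Y' \<in> \<B> \<union> set (take i (As @ [X \<inter> Y])).
        (As @ [X \<inter> Y]) ! i = (if i \<in> insert (length As) I then X' \<inter> Y' else X' \<union> Y')"
  proof (cases "i < length As")
    case True
    then show ?thesis using assms(1) by (simp add: steps_def nth_append)
  next
    case False
    with i have "i = length As" by simp
    then show ?thesis using assms(3,4) by auto
  qed
qed

text \<open>Inserted sets become list entries in the same order. Only \<open>card I \<le> k\<close>
  is claimed, since an intersection with \<open>{}\<close> counts towards \<open>k\<close> but
  appends nothing.\<close>

lemma derivable_steps:
  assumes "derivable \<B> k S" "\<B> \<subseteq> Pow \<Gamma>"
  shows "\<exists>As I. steps \<Gamma> \<B> As I \<and> card I \<le> k \<and> S \<subseteq> insert {} (\<B> \<union> set As)"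
  using assms(1)
proof induction
  case start
  have "steps \<Gamma> \<B> [] {}" by (simp add: steps_def)
  then show ?case by (intro exI[of _ "[]"] exI[of _ "{}"]) auto
next
  case (union k S X Y)
  then obtain As I where s: "steps \<Gamma> \<B> As I" "card I \<le> k" "S \<subseteq> insert {} (\<B> \<union> set As)"
    by blast
  show ?case
  proof (cases "X = {} \<or> Y = {}")
    case True
    then have "insert (X \<union> Y) S \<subseteq> insert {} (\<B> \<union> set As)" using union.hyps s by auto
    with s show ?thesis by blast
  next
    case False
    then have "X \<in> \<B> \<union> set As" "Y \<in> \<B> \<union> set As" using union.hyps s by auto
    from steps_union[OF s(1) assms(2) this] s(2,3) show ?thesis
      by (intro exI[of _ "As @ [X \<union> Y]"] exI[of _ I]) auto
  qed
next
  case (inter k S X Y)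
  then obtain As I where s: "steps \<Gamma> \<B> As I" "card I \<le> k" "S \<subseteq> insert {} (\<B> \<union> set As)"
    by blast
  show ?case
  proof (cases "X = {} \<or> Y = {}")
    case True
    then have "insert (X \<inter> Y) S \<subseteq> insert {} (\<B> \<union> set As)" using inter.hyps s by auto
    moreover have "card I \<le> Suc k" using s(2) by simp
    ultimately show ?thesis using s(1) by blast
  next
    case False
    then have "X \<in> \<B> \<union> set As" "Y \<in> \<B> \<union> set As" using inter.hyps s by auto
    note st = steps_inter[OF s(1) assms(2) this]
    have "card (insert (length As) I) \<le> Suc k"
      using s(2) card_insert_le_m1[of "Suc k" I] by simp
    with st s(3) show ?thesis
      by (intro exI[of _ "As @ [X \<inter> Y]"] exI[of _ "insert (length As) I"]) auto
  qed
qed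

lemma intersection_complexity_le:
  assumes "derivable \<B> k S" "\<B> \<subseteq> Pow \<Gamma>" "A \<in> S" "A \<noteq> {}"
  shows "intersection_complexity \<Gamma> A \<B> \<le> enat k"
proof -
  obtain As I where s: "steps \<Gamma> \<B> As I" "card I \<le> k" "S \<subseteq> insert {} (\<B> \<union> set As)"
    using derivable_steps[OF assms(1,2)] by blast
  then have "A \<in> \<B> \<union> set As" using assms(3,4) by auto
  \<comment> \<open>\<open>A\<close> may be a generator or occur early in \<open>As\<close>; the
    union step \<open>A \<union> A\<close> puts it last at no cost.\<close>
  from steps_union[OF s(1) assms(2) this this]
  have "generates \<Gamma> \<B> A (As @ [A]) I" by (simp add: steps_def generates_def)
  then have "intersection_complexity \<Gamma> A \<B> \<le> enat (card I)"
    unfolding intersection_complexity_def by (intro Inf_lower) blast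
  with s(2) show ?thesis by (meson enat_ord_simps(1) order_trans)
qed

lemma derivable_empty: "derivable \<B> k S \<Longrightarrow> {} \<in> S"
  by (induction rule: derivable.induct) auto

text \<open>Unions are not counted. The empty union is where the free \<open>{}\<close>
  enters.\<close>

lemma derivable_Union:
  assumes "finite \<C>" "derivable \<B> k S" "\<C> \<subseteq> S"
  shows "\<exists>S'. derivable \<B> k S' \<and> S \<subseteq> S' \<and> \<Union>\<C> \<in> S'"
  using assms(1,3)
proof (induction)
  case empty
  then show ?case using assms(2) derivable_empty by (intro exI[of _ S]) auto
next
  case (insert X \<C>)
  then obtain S' where "derivable \<B> k S'" "S \<subseteq> S'" "\<Union>\<C> \<in> S'" by auto
  with insert.prems show ?case
    by (intro exI[of _ "insert (X \<union> \<Union>\<C>) S'"]) (auto intro: derivable.union)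
qed

lemma derivable_Unions:
  assumes "finite J" "derivable \<B> k S" "\<And>j. j \<in> J \<Longrightarrow> finite (\<C> j) \<and> \<C> j \<subseteq> S"
  shows "\<exists>S'. derivable \<B> k S' \<and> S \<subseteq> S' \<and> (\<forall>j\<in>J. \<Union>(\<C> j) \<in> S')"
  using assms(1,3)
proof (induction)
  case empty
  then show ?case using assms(2) by auto
next
  case (insert j J)
  then obtain S1 where S1: "derivable \<B> k S1" "S \<subseteq> S1" "\<forall>j\<in>J. \<Union>(\<C> j) \<in> S1" by auto
  obtain S2 where "derivable \<B> k S2" "S1 \<subseteq> S2" "\<Union>(\<C> j) \<in> S2"
    using derivable_Union[of "\<C> j", OF _ S1(1)] insert.prems S1(2) by blast
  with S1 show ?case by (intro exI[of _ S2]) auto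
qed

lemma derivable_inters:
  assumes "finite J" "derivable \<B> k S" "\<And>j. j \<in> J \<Longrightarrow> X j \<in> S \<and> Y j \<in> S"
  shows "\<exists>S'. derivable \<B> (k + card J) S' \<and> S \<subseteq> S' \<and> (\<forall>j\<in>J. X j \<inter> Y j \<in> S')"
  using assms(1,3)
proof (induction)
  case empty
  then show ?case using assms(2) by auto
next
  case (insert j J)
  then obtain S1 where S1: "derivable \<B> (k + card J) S1" "S \<subseteq> S1" "\<forall>j\<in>J. X j \<inter> Y j \<in> S1"
    by auto
  have "derivable \<B> (Suc (k + card J)) (insert (X j \<inter> Y j) S1)"
    using S1 insert.prems by (intro derivable.inter) auto
  with S1 insert.hyps show ?case
    by (intro exI[of _ "insert (X j \<inter> Y j) S1"]) auto
qed

section \<open>Closing the family at one point under the pairs\<close>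

text \<open>\<open>G\<close> holds the pairs that have fired. Describing the family through
  \<open>G\<close> turns the closure into an iteration on subsets of \<open>\<Lambda>\<close>.
  Members are not confined to \<open>U\<close>.\<close>

definition family :: "'a set \<Rightarrow> 'a set set \<Rightarrow> 'a \<Rightarrow> ('a set \<times> 'a set) set \<Rightarrow> 'a set set" where
  "family U \<B> w G = {V. (\<exists>B\<in>\<B>. w \<in> B \<and> B \<inter> U \<subseteq> V) \<or> (\<exists>(E, H)\<in>G. E \<inter> H \<subseteq> V)}"

text \<open>\<open>G\<close> is not joined to the result: by monotonicity the iterates from
  \<open>{}\<close> increase anyway.\<close>

definition fire ::
  "'a set \<Rightarrow> 'a set set \<Rightarrow> ('a set \<times> 'a set) set \<Rightarrow> 'a \<Rightarrow> ('a set \<times> 'a set) set \<Rightarrow> ('a set \<times> 'a set) set"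
  where
  "fire U \<B> \<Lambda> w G = {(E, H). (E, H) \<in> \<Lambda> \<and> E \<in> family U \<B> w G \<and> H \<in> family U \<B> w G}"

definition family_at ::
  "'a set \<Rightarrow> 'a set set \<Rightarrow> ('a set \<times> 'a set) set \<Rightarrow> nat \<Rightarrow> 'a \<Rightarrow> 'a set set" where
  "family_at U \<B> \<Lambda> t w = family U \<B> w ((fire U \<B> \<Lambda> w ^^ t) {})"

lemma mono_fire: "mono (fire U \<B> \<Lambda> (w :: 'a))"
proof (rule monoI)
  fix G G' :: "('a set \<times> 'a set) set"
  assume "G \<subseteq> G'"
  then have "family U \<B> w G \<subseteq> family U \<B> w G'" unfolding family_def by blast
  then show "fire U \<B> \<Lambda> w G \<subseteq> fire U \<B> \<Lambda> w G'" unfolding fire_def by blast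
qed

text \<open>The iterates increase and gain an element of \<open>L\<close> in each round until they
  stabilise, so after \<open>card L\<close> rounds they are stationary or fill
  \<open>L\<close>.\<close>

lemma funpow_card_fixpoint:
  fixes f :: "'b set \<Rightarrow> 'b set"
  assumes "mono f" "finite L" "\<And>X. f X \<subseteq> L"
  shows "f ((f ^^ card L) {}) = (f ^^ card L) {}"
proof -
  have sub: "(f ^^ t) {} \<subseteq> L" for t using assms(3) by (cases t) auto
  have inc: "(f ^^ t) {} \<subseteq> f ((f ^^ t) {})" for t
    by (induction t) (auto dest: monoD[OF assms(1)])
  have grow: "f ((f ^^ t) {}) = (f ^^ t) {} \<or> t \<le> card ((f ^^ t) {})" for t
  proof (induction t)
    case (Suc t)
    show ?case
    proof (cases "f ((f ^^ t) {}) = (f ^^ t) {}")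
      case False
      then have "(f ^^ t) {} \<subset> f ((f ^^ t) {})" using inc by blast
      then have "card ((f ^^ t) {}) < card (f ((f ^^ t) {}))"
        using psubset_card_mono finite_subset[OF assms(3) assms(2)] by blast
      with Suc False show ?thesis by auto
    qed simp
  qed simp
  show ?thesis
  proof (cases "f ((f ^^ card L) {}) = (f ^^ card L) {}")
    case False
    with grow have "card L \<le> card ((f ^^ card L) {})" by blast
    then have "(f ^^ card L) {} = L" using card_seteq[OF assms(2) sub] by blast
    then show ?thesis using inc[of "card L"] assms(3) by auto
  qed
qed

text \<open>Eliminating the fired pairs leaves a recursion on \<open>t\<close>. For fixed
  \<open>V\<close>, the second disjunct places \<open>w\<close> in the intersection of two point
  sets of round \<open>t\<close>, which is what an intersection step builds.\<close>

lemma family_at_Suc: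
  "V \<in> family_at U \<B> \<Lambda> (Suc t) w \<longleftrightarrow>
     (\<exists>B\<in>\<B>. w \<in> B \<and> B \<inter> U \<subseteq> V) \<or>
     (\<exists>(E, H)\<in>\<Lambda>. E \<in> family_at U \<B> \<Lambda> t w \<and> H \<in> family_at U \<B> \<Lambda> t w \<and> E \<inter> H \<subseteq> V)"
proof -
  have "family_at U \<B> \<Lambda> (Suc t) w = family U \<B> w
      {(E, H). (E, H) \<in> \<Lambda> \<and> E \<in> family_at U \<B> \<Lambda> t w \<and> H \<in> family_at U \<B> \<Lambda> t w}"
    by (simp add: family_at_def fire_def)
  then show ?thesis by (auto simp: family_def)
qed

lemma family_at_0: "V \<in> family_at U \<B> \<Lambda> 0 w \<longleftrightarrow> (\<exists>B\<in>\<B>. w \<in> B \<and> B \<inter> U \<subseteq> V)"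
  by (auto simp: family_at_def family_def)

text \<open>The intersection enters one round later at the latest, and round
  \<open>card \<Lambda>\<close> is already stationary.\<close>

lemma family_at_card_closed:
  assumes "finite \<Lambda>" "(E, H) \<in> \<Lambda>"
    and "E \<in> family_at U \<B> \<Lambda> (card \<Lambda>) w" "H \<in> family_at U \<B> \<Lambda> (card \<Lambda>) w"
  shows "E \<inter> H \<in> family_at U \<B> \<Lambda> (card \<Lambda>) w"
proof -
  have "fire U \<B> \<Lambda> w X \<subseteq> \<Lambda>" for X by (auto simp: fire_def)
  then have "family_at U \<B> \<Lambda> (Suc (card \<Lambda>)) w = family_at U \<B> \<Lambda> (card \<Lambda>) w"
    by (simp add: family_at_def funpow_card_fixpoint[OF mono_fire assms(1)])
  moreover have "E \<inter> H \<in> family_at U \<B> \<Lambda> (Suc (card \<Lambda>)) w"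
    unfolding family_at_Suc using assms(2-4) by (intro disjI2 bexI[of _ "(E, H)"]) auto
  ultimately show ?thesis by simp
qed

text \<open>A point of \<open>U\<close> lies in \<open>B \<inter> U\<close> whenever it lies in
  \<open>B\<close>, and intersections keep it. Hence points of \<open>U\<close> never reach
  \<open>V = {}\<close>.\<close>

lemma family_at_mem:
  assumes "w \<in> U" "V \<in> family_at U \<B> \<Lambda> t w"
  shows "w \<in> V"
  using assms(2)
proof (induction t arbitrary: V)
  case 0
  then show ?case using assms(1) by (auto simp: family_at_0)
next
  case (Suc t)
  then show ?case using assms(1) by (fastforce simp: family_at_Suc)
qed

text \<open>Adding \<open>U\<close> makes the family nonempty also when no generator contains \<open>a\<close>.\<close>

lemma empty_in_family_at:
  assumes cov: "covering_collection \<Gamma> A \<B> \<Lambda>" and fin: "finite \<Lambda>" and "\<Gamma> - A \<noteq> {}" and "a \<in> A"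
  shows "{} \<in> family_at (\<Gamma> - A) \<B> \<Lambda> (card \<Lambda>) a"
proof (rule ccontr)
  let ?U = "\<Gamma> - A"
  let ?C = "family_at ?U \<B> \<Lambda> (card \<Lambda>) a"
  let ?F = "insert ?U (Pow ?U \<inter> ?C)"
  assume no: "{} \<notin> ?C"
  have up: "W \<in> ?C" if "V \<in> ?C" "V \<subseteq> W" for V W
    using that unfolding family_at_def family_def by blast
  have "semi_filter ?U ?F"
    unfolding semi_filter_def using no assms(3) up by blast
  moreover have "preserves ?F \<Lambda>"
    unfolding preserves_def
  proof (intro ballI case_prodI2 impI)
    fix p E H assume "p \<in> \<Lambda>" "p = (E, H)" "E \<in> ?F \<and> H \<in> ?F"
    then have EH: "(E, H) \<in> \<Lambda>" "E \<in> ?F" "H \<in> ?F" by blast+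
    \<comment> \<open>\<open>?U\<close> is neutral for intersection with its subsets, so only the
      case inside \<open>?C\<close> needs closure under firing.\<close>
    then consider "E = ?U" | "H = ?U" | "E \<in> ?C" "H \<in> ?C" by blast
    then show "E \<inter> H \<in> ?F"
    proof cases
      case 1
      then have "E \<inter> H = H" using EH(3) by blast
      with EH(3) show ?thesis by argo
    next
      case 2
      then have "E \<inter> H = E" using EH(2) by blast
      with EH(2) show ?thesis by argo
    next
      case 3
      then have "E \<inter> H \<in> ?C" using family_at_card_closed[OF fin EH(1)] by blast
      then show ?thesis using EH(2) by blast
    qed
  qed
  moreover have "above ?U \<B> ?F a"
    unfolding above_def family_at_def family_def by blast
  ultimately show False using cov \<open>a \<in> A\<close> unfolding covering_collection_def by blast
qed

section \<open>Building the point sets round by round\<close>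

text \<open>All \<open>V\<close> are treated together because the pairs may have any subsets of
  \<open>U\<close> as components. Round 0 needs only unions of generators.\<close>

lemma derivable_family_at:
  assumes "finite \<B>" "\<B> \<subseteq> Pow \<Gamma>" "finite \<Lambda>" "\<Lambda> \<subseteq> Pow U \<times> Pow U" "finite U"
  shows "\<exists>S. derivable \<B> (t * card \<Lambda>) S \<and> \<B> \<subseteq> S \<and>
           (\<forall>V\<in>Pow U. {w\<in>\<Gamma>. V \<in> family_at U \<B> \<Lambda> t w} \<in> S)"
proof (induction t)
  case 0
  let ?C = "\<lambda>V. {B\<in>\<B>. B \<inter> U \<subseteq> V}"
  have eq: "{w\<in>\<Gamma>. V \<in> family_at U \<B> \<Lambda> 0 w} = \<Union>(?C V)" for V
    using assms(2) by (auto simp: family_at_0)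
  have "\<exists>S. derivable \<B> 0 S \<and> insert {} \<B> \<subseteq> S \<and> (\<forall>V\<in>Pow U. \<Union>(?C V) \<in> S)"
    by (rule derivable_Unions) (use assms in \<open>auto intro: derivable.start\<close>)
  then show ?case unfolding eq by auto
next
  case (Suc t)
  define W where "W V = {w\<in>\<Gamma>. V \<in> family_at U \<B> \<Lambda> t w}" for V
  from Suc obtain S where S: "derivable \<B> (t * card \<Lambda>) S" "\<B> \<subseteq> S" "\<forall>V\<in>Pow U. W V \<in> S"
    unfolding W_def by blast
  have "\<exists>S'. derivable \<B> (t * card \<Lambda> + card \<Lambda>) S' \<and> S \<subseteq> S' \<and>
          (\<forall>p\<in>\<Lambda>. W (fst p) \<inter> W (snd p) \<in> S')"
    by (rule derivable_inters) (use assms S in auto)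
  then obtain S1 where S1: "derivable \<B> (t * card \<Lambda> + card \<Lambda>) S1" "S \<subseteq> S1"
    "\<forall>p\<in>\<Lambda>. W (fst p) \<inter> W (snd p) \<in> S1" by blast
  \<comment> \<open>An intersection depends on its pair alone; \<open>V\<close> merely selects which
    ones enter the union. So \<open>card \<Lambda>\<close> intersections serve every
    \<open>V\<close>.\<close>
  let ?C = "\<lambda>V. {B\<in>\<B>. B \<inter> U \<subseteq> V} \<union>
      (\<lambda>p. W (fst p) \<inter> W (snd p)) ` {p\<in>\<Lambda>. fst p \<inter> snd p \<subseteq> V}"
  have eq: "{w\<in>\<Gamma>. V \<in> family_at U \<B> \<Lambda> (Suc t) w} = \<Union>(?C V)" for V
  proof -
    have "w \<in> \<Gamma>" if "B \<in> \<B>" "w \<in> B" for w B using that assms(2) by blast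
    then show ?thesis by (auto simp: family_at_Suc W_def split_beta)
  qed
  have "\<exists>S'. derivable \<B> (t * card \<Lambda> + card \<Lambda>) S' \<and> S1 \<subseteq> S' \<and> (\<forall>V\<in>Pow U. \<Union>(?C V) \<in> S')"
    by (rule derivable_Unions) (use assms S S1 in auto)
  then show ?case unfolding eq using S(2) S1(2) by (auto simp: add.commute)
qed

theorem theorem3p6:
  fixes \<Gamma> A :: "'a set" and \<B> :: "'a set set"
  assumes "finite \<Gamma>" and "\<Gamma> \<noteq> {}"
    and "A \<subseteq> \<Gamma>" and "A \<noteq> {}" and "A \<noteq> \<Gamma>"
    and "\<B> \<subseteq> Pow \<Gamma>" and "\<B> \<noteq> {}"
  shows "intersection_complexity \<Gamma> A \<B> \<le> (cover_complexity \<Gamma> A \<B>)\<^sup>2"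
proof (cases "\<exists>\<Lambda>. covering_collection \<Gamma> A \<B> \<Lambda>")
  case False
  then have "cover_complexity \<Gamma> A \<B> = \<infinity>"
    by (simp add: cover_complexity_def Inf_enat_def)
  then show ?thesis by (simp add: power2_eq_square)
next
  case True
  then obtain \<Lambda>0 where cov0: "covering_collection \<Gamma> A \<B> \<Lambda>0" by blast
  let ?U = "\<Gamma> - A"
  \<comment> \<open>\<open>enat\<close> is well-ordered, so the infimum is attained by an actual
    collection.\<close>
  have "cover_complexity \<Gamma> A \<B> \<in> {enat (card \<Lambda>) | \<Lambda>. covering_collection \<Gamma> A \<B> \<Lambda>}"
    unfolding cover_complexity_def by (rule wellorder_InfI[of "enat (card \<Lambda>0)"]) (use cov0 in blast)
  then obtain \<Lambda> where cov: "covering_collection \<Gamma> A \<B> \<Lambda>"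
    and c: "cover_complexity \<Gamma> A \<B> = enat (card \<Lambda>)" by blast
  have sub: "\<Lambda> \<subseteq> Pow ?U \<times> Pow ?U" using cov by (simp add: covering_collection_def)
  then have fin: "finite \<Lambda>" using assms(1) by (auto intro: finite_subset)
  have "finite \<B>" using assms(1,6) by (auto intro: finite_subset)
  then obtain S where S: "derivable \<B> (card \<Lambda> * card \<Lambda>) S"
    "{w\<in>\<Gamma>. {} \<in> family_at ?U \<B> \<Lambda> (card \<Lambda>) w} \<in> S"
    using derivable_family_at[OF _ assms(6) fin sub, of "card \<Lambda>"] assms(1) by auto
  have "?U \<noteq> {}" using assms(3,5) by blast
  \<comment> \<open>\<open>empty_in_family_at\<close> puts every point of \<open>A\<close> into this
    set, and \<open>family_at_mem\<close> keeps the points of \<open>?U\<close> out.\<close>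
  then have "{w\<in>\<Gamma>. {} \<in> family_at ?U \<B> \<Lambda> (card \<Lambda>) w} = A"
    using empty_in_family_at[OF cov fin] family_at_mem[of _ ?U "{}"] assms(3) by blast
  with S have "intersection_complexity \<Gamma> A \<B> \<le> enat (card \<Lambda> * card \<Lambda>)"
    using intersection_complexity_le[OF _ assms(6) _ assms(4)] by auto
  then show ?thesis by (simp add: c power2_eq_square)
qed

end
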